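(* For $n\in\mathbb N=\{1,2,3,\ldots\}$, the Bott invariant of (the restriction to $TS^3$ of) $\omega_n=n z_1\,\mathrm dz_2-z_2\,\mathrm dz_1+z_2^n\,\mathrm dz_2$ equals $$-4\pi^2\,\frac{(n+1)^2}{n}.$$
   Context: $S^3\subset\mathbb C^2$ is the unit sphere with its standard orientation as the boundary of the unit ball. The restriction of $\omega_n$ to $TS^3$ is a formally integrable complex $1$-form: its real and imaginary parts are pointwise linearly independent and $\omega_n\wedge\mathrm d\omega_n=0$. Bott invariant: for a formally integrable complex $1$-form $\omega_{\mathrm c}$ (complex-valued $1$-form with pointwise linearly independent real and imaginary parts and $\omega_{\mathrm c}\wedge\mathrm d\omega_{\mathrm c}=0$) on a closed, connected, oriented $3$-manifold $M$ there is a complex-valued $1$-form $\alpha_{\mathrm c}$ with $\mathrm d\omega_{\mathrm c}=\alpha_{\mathrm c}\wedge\omega_{\mathrm c}$, and the Bott invariant is the complex number $\int_M\alpha_{\mathrm c}\wedge\mathrm d\alpha_{\mathrm c}$, which is independent of the choice of $\alpha_{\mathrm c}$. *)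

theory Defs
  imports "HOL-Analysis.Analysis"
begin

text \<open>
  The space \<open>\<complex>\<^sup>2\<close> is \<open>complex \<times> complex\<close>; its real inner product is the Euclidean one of \<open>\<real>\<^sup>4\<close>.
  A complex-valued differential form assigns to a point a function of the appropriate number of
  (real) tangent vectors.

  Forms on \<open>S\<^sup>3\<close> are represented by smooth forms on some open neighbourhood of \<open>S\<^sup>3\<close> in \<open>\<complex>\<^sup>2\<close>, and
  every condition on them is imposed only on vectors tangent to \<open>S\<^sup>3\<close>.  No form on \<open>S\<^sup>3\<close> is lost:
  \<open>S\<^sup>3\<close> is a closed submanifold, so each smooth form on it extends (e.g. by pulling back along
  \<open>x \<mapsto> x / \<bar>x\<bar>\<close>).  Since exterior derivative and wedge product commute with restriction, the
  restrictions to \<open>TS\<^sup>3\<close> of the forms computed in the ambient space are the intrinsic ones.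
\<close>

type_synonym complex2 = "complex \<times> complex"
type_synonym form1 = "complex2 \<Rightarrow> complex2 \<Rightarrow> complex"
type_synonym form2 = "complex2 \<Rightarrow> complex2 \<Rightarrow> complex2 \<Rightarrow> complex"
type_synonym form3 = "complex2 \<Rightarrow> complex2 \<Rightarrow> complex2 \<Rightarrow> complex2 \<Rightarrow> complex"

abbreviation S3 :: "complex2 set" where
  "S3 \<equiv> sphere 0 1"

definition tangent_S3 :: "complex2 \<Rightarrow> complex2 set" where
  "tangent_S3 p = {v. p \<bullet> v = 0}"

primrec Ck_on :: "nat \<Rightarrow> 'a set \<Rightarrow> ('a::real_normed_vector \<Rightarrow> 'b::real_normed_vector) \<Rightarrow> bool" where
  "Ck_on 0 U f \<longleftrightarrow> continuous_on U f"
| "Ck_on (Suc k) U f \<longleftrightarrow>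
     (\<forall>x\<in>U. f differentiable (at x)) \<and> (\<forall>v. Ck_on k U (\<lambda>x. frechet_derivative f (at x) v))"

definition smooth_on :: "'a set \<Rightarrow> ('a::real_normed_vector \<Rightarrow> 'b::real_normed_vector) \<Rightarrow> bool" where
  "smooth_on U f \<longleftrightarrow> (\<forall>k. Ck_on k U f)"

definition smooth_form1_near_S3 :: "form1 \<Rightarrow> bool" where
  "smooth_form1_near_S3 \<alpha> \<longleftrightarrow>
     (\<exists>U. open U \<and> S3 \<subseteq> U \<and> (\<forall>p\<in>U. linear (\<alpha> p)) \<and> (\<forall>v. smooth_on U (\<lambda>p. \<alpha> p v)))"

text \<open>
  Normalisation: \<open>(\<alpha> \<and> \<beta>)(u, v) = \<alpha>(u)\<beta>(v) - \<alpha>(v)\<beta>(u)\<close>, and \<open>d\<alpha>(u, v) = \<partial>\<^sub>u(\<alpha>(v)) - \<partial>\<^sub>v(\<alpha>(u))\<close> for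
  constant vector fields \<open>u\<close>, \<open>v\<close>; thus \<open>d(x dy) = dx \<and> dy\<close> takes the value 1 on \<open>(\<partial>\<^sub>x, \<partial>\<^sub>y)\<close>.
\<close>

definition ext_deriv :: "form1 \<Rightarrow> form2" where
  "ext_deriv \<alpha> p u v =
     frechet_derivative (\<lambda>x. \<alpha> x v) (at p) u - frechet_derivative (\<lambda>x. \<alpha> x u) (at p) v"

definition wedge11 :: "form1 \<Rightarrow> form1 \<Rightarrow> form2" where
  "wedge11 \<alpha> \<beta> p u v = \<alpha> p u * \<beta> p v - \<alpha> p v * \<beta> p u"

definition wedge12 :: "form1 \<Rightarrow> form2 \<Rightarrow> form3" where
  "wedge12 \<alpha> \<beta> p u v w = \<alpha> p u * \<beta> p v w - \<alpha> p v * \<beta> p u w + \<alpha> p w * \<beta> p u v"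

text \<open>
  The surface measure of the unit sphere, as cone measure: a subset \<open>A\<close> of the sphere gets
  \<open>DIM('a)\<close> times the Lebesgue measure of \<open>{t *\<^sub>R x | x \<in> A, 0 < t < 1}\<close>.  Recall that
  \<open>sgn x = x /\<^sub>R norm x\<close>; the origin, where \<open>sgn\<close> vanishes, is a null set.
\<close>

definition sphere_measure :: "'a::euclidean_space measure" where
  "sphere_measure =
     density (distr (restrict_space lborel (ball 0 1)) borel sgn) (\<lambda>_. ennreal (real DIM('a)))"

text \<open>
  A global orthonormal frame of \<open>TS\<^sup>3\<close>.  With the outward normal first, \<open>(p, frame1 p, frame2 p,
  frame3 p)\<close> is a positive basis of \<open>\<complex>\<^sup>2\<close> (coordinates \<open>x\<^sub>1, y\<^sub>1, x\<^sub>2, y\<^sub>2\<close>): it depends continuously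
  on \<open>p\<close>, \<open>S\<^sup>3\<close> is connected, and at \<open>p = (1, 0)\<close> it is the standard basis.
\<close>

definition frame1 :: "complex2 \<Rightarrow> complex2" where
  "frame1 p = (\<i> * fst p, \<i> * snd p)"

definition frame2 :: "complex2 \<Rightarrow> complex2" where
  "frame2 p = (- cnj (snd p), cnj (fst p))"

definition frame3 :: "complex2 \<Rightarrow> complex2" where
  "frame3 p = (- \<i> * cnj (snd p), \<i> * cnj (fst p))"

lemma frame_at_base_point:
  "frame1 (1, 0) = (\<i>, 0)" "frame2 (1, 0) = (0, 1)" "frame3 (1, 0) = (0, \<i>)"
  by (simp_all add: frame1_def frame2_def frame3_def)

lemma frame_tangent:
  "frame1 p \<in> tangent_S3 p" "frame2 p \<in> tangent_S3 p" "frame3 p \<in> tangent_S3 p"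
  by (cases p; simp add: frame1_def frame2_def frame3_def tangent_S3_def inner_complex_def
      algebra_simps)+

lemma frame_orthogonal:
  "frame1 p \<bullet> frame2 p = 0" "frame1 p \<bullet> frame3 p = 0" "frame2 p \<bullet> frame3 p = 0"
  by (cases p; simp add: frame1_def frame2_def frame3_def inner_complex_def algebra_simps)+

lemma frame_norm:
  "norm (frame1 p) = norm p" "norm (frame2 p) = norm p" "norm (frame3 p) = norm p"
  by (cases p; simp add: frame1_def frame2_def frame3_def norm_Pair norm_mult add.commute)+

text \<open>
  The Riemannian volume form of \<open>S\<^sup>3\<close> is 1 on the frame, so the integral of a 3-form is the integral
  of its value on the frame against the surface measure.
\<close>

definition integral_S3 :: "form3 \<Rightarrow> complex" where
  "integral_S3 \<beta> = (LINT p:S3|sphere_measure. \<beta> p (frame1 p) (frame2 p) (frame3 p))"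

definition formally_integrable :: "form1 \<Rightarrow> bool" where
  "formally_integrable \<omega> \<longleftrightarrow>
     smooth_form1_near_S3 \<omega> \<and>
     (\<forall>p\<in>S3. \<forall>a b :: real.
        (\<forall>v\<in>tangent_S3 p. a * Re (\<omega> p v) + b * Im (\<omega> p v) = 0) \<longrightarrow> a = 0 \<and> b = 0) \<and>
     (\<forall>p\<in>S3. \<forall>u\<in>tangent_S3 p. \<forall>v\<in>tangent_S3 p. \<forall>w\<in>tangent_S3 p.
        wedge12 \<omega> (ext_deriv \<omega>) p u v w = 0)"

text \<open>
  The invariant is defined only for formally integrable forms; for any other form (and if the
  integral depended on the choice of \<open>\<alpha>\<close>) the description below has no unique solution.
\<close>

definition bott_invariant :: "form1 \<Rightarrow> complex" where
  "bott_invariant \<omega> = (THE c. formally_integrable \<omega> \<and>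
     (\<exists>\<alpha>. smooth_form1_near_S3 \<alpha> \<and>
        (\<forall>p\<in>S3. \<forall>u\<in>tangent_S3 p. \<forall>v\<in>tangent_S3 p.
           ext_deriv \<omega> p u v = wedge11 \<alpha> \<omega> p u v) \<and>
        c = integral_S3 (wedge12 \<alpha> (ext_deriv \<alpha>))))"

text \<open>\<open>\<omega>\<^sub>n = n z\<^sub>1 dz\<^sub>2 - z\<^sub>2 dz\<^sub>1 + z\<^sub>2\<^sup>n dz\<^sub>2\<close>\<close>

definition omega :: "nat \<Rightarrow> form1" where
  "omega n p v =
     of_nat n * fst p * snd v - snd p * fst v + snd p ^ n * snd v"

end

theory Submission
  imports Defs
begin

text \<open>
  Write \<open>z, w\<close> for the coordinates of \<open>\<complex>\<^sup>2\<close>.  The form \<open>\<omega>\<^sub>n\<close> is \<open>dz \<and> dw\<close> contracted with the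
  holomorphic vector field \<open>X = (n z + w\<^sup>n) \<partial>\<^sub>z + w \<partial>\<^sub>w\<close>, and \<open>d\<omega>\<^sub>n = (n + 1) dz \<and> dw\<close>.  Hence a
  \<open>(1,0)\<close>-form \<open>\<alpha>\<close> satisfies \<open>d\<omega>\<^sub>n = \<alpha> \<and> \<omega>\<^sub>n\<close> exactly where \<open>\<alpha>(X) = n + 1\<close>.  The polynomial choice
  \<open>\<alpha> = (n + 1) (cnj z / n dz + (cnj w - cnj z w\<^bsup>n-1\<^esup> / n) dw)\<close> has
  \<open>\<alpha>(X) = (n + 1) (\<bar>z\<bar>\<^sup>2 + \<bar>w\<bar>\<^sup>2)\<close>: the coefficient of \<open>dw\<close> is chosen so as to absorb the resonant term
  \<open>w\<^sup>n\<close>.  In \<open>\<alpha> \<and> d\<alpha>\<close> the resonant terms cancel, and on \<open>S\<^sup>3\<close> it is the constant \<open>-2 (n + 1)\<^sup>2 / n\<close>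
  times the volume form (lemma \<open>wedge12_connection_form\<close>).  As \<open>S\<^sup>3\<close> has volume \<open>2 \<pi>\<^sup>2\<close>, this choice of
  \<open>\<alpha>\<close> yields the asserted value.

  The invariant is defined as a unique value, so every other admissible \<open>\<alpha>'\<close> has to give the same
  integral.  On the sphere \<open>\<alpha>' = \<alpha> + f \<omega>\<^sub>n\<close> for a differentiable function \<open>f\<close>
  (\<open>connection_form_difference\<close>).  Exterior differentiation commutes with restriction to the sphere
  (\<open>ext_deriv_tangent_zero\<close>), so \<open>\<alpha>' \<and> d\<alpha>' - \<alpha> \<and> d\<alpha> = - df \<and> d\<omega>\<^sub>n\<close> there
  (\<open>wedge12_change_of_connection\<close>).  This form is exact; instead of the general theorem of Stokes the
  proof uses that, on the frame, \<open>df \<and> d\<omega>\<^sub>n\<close> is a combination of the derivatives of \<open>f\<close> along the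
  second and third frame fields.  Both fields generate rotations of the sphere, and the integral of a
  derivative along such a field vanishes because the surface measure is rotation invariant
  (\<open>integral_rotation_derivative\<close>).
\<close>

section \<open>Functions of class \<open>C\<^sup>k\<close> on open sets\<close>

lemma Ck_on_cong_imp:
  assumes "open U" "\<And>x. x \<in> U \<Longrightarrow> f x = g x" "Ck_on k U f"
  shows "Ck_on k U g"
  using assms(2,3)
proof (induction k arbitrary: f g)
  case 0
  then show ?case using continuous_on_cong by force
next
  case (Suc k)
  have d: "g differentiable (at x)" if x: "x \<in> U" for x
  proof -
    have "(f has_derivative frechet_derivative f (at x)) (at x)"
      using Suc.prems(2) x frechet_derivative_works by auto
    then have "(g has_derivative frechet_derivative f (at x)) (at x)"
      by (rule has_derivative_transform_within_open[OF _ assms(1) x]) (rule Suc.prems(1))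
    then show ?thesis unfolding differentiable_def by blast
  qed
  have eq: "frechet_derivative f (at x) = frechet_derivative g (at x)" if "x \<in> U" for x
    using Suc.prems that by (intro frechet_derivative_transform_within_open[OF _ assms(1)]) auto
  have "Ck_on k U (\<lambda>x. frechet_derivative g (at x) v)" for v
  proof (rule Suc.IH)
    show "Ck_on k U (\<lambda>x. frechet_derivative f (at x) v)" using Suc.prems(2) by simp
  qed (simp add: eq)
  with d show ?case by simp
qed

lemma Ck_on_SucD: "Ck_on (Suc k) U f \<Longrightarrow> Ck_on k U f"
proof (induction k arbitrary: f)
  case 0
  then show ?case
    by (auto intro!: continuous_at_imp_continuous_on differentiable_imp_continuous_within)
next
  case (Suc k)
  then show ?case by (metis Ck_on.simps(2))
qed

lemma Ck_on_1_differentiable: "Ck_on 1 U f \<Longrightarrow> x \<in> U \<Longrightarrow> f differentiable (at x)"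
  by simp

lemma Ck_on_const: "Ck_on k U (\<lambda>x. c)"
  by (induction k arbitrary: c) auto

lemma Ck_on_bounded_linear:
  assumes "bounded_linear L"
  shows "Ck_on k U L"
proof (cases k)
  case 0
  then show ?thesis using assms by (simp add: linear_continuous_on)
next
  case (Suc m)
  have "frechet_derivative L (at x) = L" for x
    by (rule frechet_derivative_at[symmetric, OF bounded_linear_imp_has_derivative[OF assms]])
  then show ?thesis
    using Suc assms Ck_on_const bounded_linear_imp_differentiable by auto
qed

lemma frechet_derivative_add:
  assumes "f differentiable (at x)" "g differentiable (at x)"
  shows "frechet_derivative (\<lambda>x. f x + g x) (at x) v =
    frechet_derivative f (at x) v + frechet_derivative g (at x) v"
  using fun_cong[OF frechet_derivative_at[OF has_derivative_add[OF assms[unfolded frechet_derivative_works]]], of v]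
  by (rule sym)

lemma frechet_derivative_diff:
  assumes "f differentiable (at x)" "g differentiable (at x)"
  shows "frechet_derivative (\<lambda>x. f x - g x) (at x) v =
    frechet_derivative f (at x) v - frechet_derivative g (at x) v"
  using fun_cong[OF frechet_derivative_at[OF has_derivative_diff[OF assms[unfolded frechet_derivative_works]]], of v]
  by (rule sym)

lemma frechet_derivative_mult:
  fixes f g :: "'a::real_normed_vector \<Rightarrow> 'b::real_normed_algebra"
  assumes "f differentiable (at x)" "g differentiable (at x)"
  shows "frechet_derivative (\<lambda>x. f x * g x) (at x) v =
    f x * frechet_derivative g (at x) v + frechet_derivative f (at x) v * g x"
  using fun_cong[OF frechet_derivative_at[OF has_derivative_mult[OF assms[unfolded frechet_derivative_works]]], of v]
  by (rule sym)

lemma Ck_on_add: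
  assumes "open U" "Ck_on k U f" "Ck_on k U g"
  shows "Ck_on k U (\<lambda>x. f x + g x)"
  using assms(2,3)
proof (induction k arbitrary: f g)
  case 0
  then show ?case by (auto intro: continuous_on_add)
next
  case (Suc k)
  have "Ck_on k U (\<lambda>x. frechet_derivative (\<lambda>x. f x + g x) (at x) v)" for v
  proof (rule Ck_on_cong_imp[OF assms(1)])
    show "Ck_on k U (\<lambda>x. frechet_derivative f (at x) v + frechet_derivative g (at x) v)"
      using Suc.prems by (intro Suc.IH) simp_all
  qed (use Suc.prems in \<open>simp add: frechet_derivative_add\<close>)
  then show ?case using Suc.prems by (simp add: differentiable_add)
qed

lemma Ck_on_mult:
  fixes f g :: "'a::real_normed_vector \<Rightarrow> 'b::real_normed_algebra"
  assumes "open U" "Ck_on k U f" "Ck_on k U g"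
  shows "Ck_on k U (\<lambda>x. f x * g x)"
  using assms(2,3)
proof (induction k arbitrary: f g)
  case 0
  then show ?case by (auto intro: continuous_on_mult)
next
  case (Suc k)
  have "Ck_on k U (\<lambda>x. frechet_derivative (\<lambda>x. f x * g x) (at x) v)" for v
  proof (rule Ck_on_cong_imp[OF assms(1)])
    have "Ck_on k U (\<lambda>x. frechet_derivative f (at x) v)" "Ck_on k U (\<lambda>x. frechet_derivative g (at x) v)"
      using Suc.prems by simp_all
    then show "Ck_on k U (\<lambda>x. f x * frechet_derivative g (at x) v + frechet_derivative f (at x) v * g x)"
      by (intro Ck_on_add assms(1) Suc.IH Suc.prems[THEN Ck_on_SucD])
  qed (use Suc.prems in \<open>simp add: frechet_derivative_mult\<close>)
  then show ?case using Suc.prems by (simp add: differentiable_mult)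
qed

lemma Ck_on_power:
  fixes f :: "'a::real_normed_vector \<Rightarrow> 'b::real_normed_algebra_1"
  assumes "open U" "Ck_on k U f"
  shows "Ck_on k U (\<lambda>x. f x ^ m)"
  by (induction m) (auto intro: Ck_on_mult Ck_on_const assms)

lemma Ck_on_diff:
  fixes f g :: "'a::real_normed_vector \<Rightarrow> 'b::real_normed_algebra_1"
  assumes "open U" "Ck_on k U f" "Ck_on k U g"
  shows "Ck_on k U (\<lambda>x. f x - g x)"
  using Ck_on_add[OF assms(1,2) Ck_on_mult[OF assms(1) Ck_on_const[of k U "- 1"] assms(3)]] by simp

lemma Ck_on_sum:
  assumes "open U" "\<And>i. i \<in> I \<Longrightarrow> Ck_on k U (f i)"
  shows "Ck_on k U (\<lambda>x. \<Sum>i\<in>I. f i x)"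
  using assms(2) by (induction I rule: infinite_finite_induct) (auto intro: Ck_on_add Ck_on_const assms(1))

text \<open>
  The class \<open>C\<^sup>1\<close> only speaks of derivatives in constant directions; linearity of the derivative
  extends continuity to directions that vary with the point.
\<close>

lemma continuous_on_frechet_derivative_along:
  fixes f :: "'a::euclidean_space \<Rightarrow> 'b::real_normed_vector"
  assumes f: "Ck_on 1 U f" and K: "continuous_on U K"
  shows "continuous_on U (\<lambda>x. frechet_derivative f (at x) (K x))"
proof -
  have "continuous_on U (\<lambda>x. \<Sum>b\<in>Basis. (K x \<bullet> b) *\<^sub>R frechet_derivative f (at x) b)"
    using f by (intro continuous_intros K) auto
  moreover have "(\<Sum>b\<in>Basis. (K x \<bullet> b) *\<^sub>R frechet_derivative f (at x) b) =
      frechet_derivative f (at x) (K x)" if "x \<in> U" for x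
  proof -
    have l: "linear (frechet_derivative f (at x))"
      using f that by (auto intro: linear_frechet_derivative)
    have "frechet_derivative f (at x) (K x) =
        frechet_derivative f (at x) (\<Sum>b\<in>Basis. (K x \<bullet> b) *\<^sub>R b)"
      by (simp add: euclidean_representation)
    also have "\<dots> = (\<Sum>b\<in>Basis. (K x \<bullet> b) *\<^sub>R frechet_derivative f (at x) b)"
      by (simp add: linear_sum[OF l] linear_scale[OF l])
    finally show ?thesis by simp
  qed
  ultimately show ?thesis by (simp cong: continuous_on_cong)
qed

section \<open>Exterior derivative and restriction to the sphere\<close>

lemma linear_form_expand:
  fixes \<phi> :: "'a::euclidean_space \<Rightarrow> complex"
  assumes "linear \<phi>"
  shows "(\<Sum>b\<in>Basis. of_real (v \<bullet> b) * \<phi> b) = \<phi> v"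
proof -
  have "\<phi> v = \<phi> (\<Sum>b\<in>Basis. (v \<bullet> b) *\<^sub>R b)" by (simp add: euclidean_representation)
  also have "\<dots> = (\<Sum>b\<in>Basis. of_real (v \<bullet> b) * \<phi> b)"
    by (simp add: linear_sum[OF assms] linear_scale[OF assms] scaleR_conv_of_real)
  finally show ?thesis by simp
qed

text \<open>
  Smoothness of a form is known for its values on constant vectors; expanding a linear vector field
  in the standard basis transfers it to such fields.
\<close>

lemma Ck_on_form_linear_field:
  fixes \<gamma> :: form1
  assumes U: "open U" and lin: "\<And>x. x \<in> U \<Longrightarrow> linear (\<gamma> x)"
    and C: "\<And>v. Ck_on k U (\<lambda>x. \<gamma> x v)" and J: "bounded_linear J"
  shows "Ck_on k U (\<lambda>x. \<gamma> x (J x))"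
proof (rule Ck_on_cong_imp[OF U])
  show "Ck_on k U (\<lambda>x. \<Sum>b\<in>Basis. of_real (J x \<bullet> b) * \<gamma> x b)"
  proof (intro Ck_on_sum[OF U] Ck_on_mult[OF U] C)
    show "Ck_on k U (\<lambda>x. complex_of_real (J x \<bullet> b))" for b
      by (rule Ck_on_bounded_linear[OF bounded_linear_compose[OF bounded_linear_of_real
            bounded_linear_compose[OF bounded_linear_inner_left J]]])
  qed
qed (simp add: linear_form_expand lin)

lemma has_derivative_form_linear_field:
  fixes \<gamma> :: form1
  assumes U: "open U" "p \<in> U" and lin: "\<And>x. x \<in> U \<Longrightarrow> linear (\<gamma> x)"
    and d: "\<And>v. (\<lambda>x. \<gamma> x v) differentiable (at p)" and J: "bounded_linear J"
  shows "((\<lambda>x. \<gamma> x (J x)) has_derivative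
    (\<lambda>u. frechet_derivative (\<lambda>x. \<gamma> x (J p)) (at p) u + \<gamma> p (J u))) (at p)"
proof -
  define D where "D b = frechet_derivative (\<lambda>x. \<gamma> x b) (at p)" for b
  have D: "((\<lambda>x. \<gamma> x b) has_derivative D b) (at p)" for b
    using d unfolding D_def frechet_derivative_works by blast
  have L: "((\<lambda>x. of_real (J x \<bullet> b) :: complex) has_derivative (\<lambda>u. of_real (J u \<bullet> b))) (at p)" for b
    by (rule bounded_linear_imp_has_derivative[OF bounded_linear_compose[OF bounded_linear_of_real
            bounded_linear_compose[OF bounded_linear_inner_left J]]])
  have "((\<lambda>x. \<Sum>b\<in>Basis. of_real (J x \<bullet> b) * \<gamma> x b) has_derivative
      (\<lambda>u. \<Sum>b\<in>Basis. of_real (J p \<bullet> b) * D b u + of_real (J u \<bullet> b) * \<gamma> p b)) (at p)"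
    by (intro has_derivative_sum has_derivative_mult L D)
  then have 1: "((\<lambda>x. \<gamma> x (J x)) has_derivative
      (\<lambda>u. \<Sum>b\<in>Basis. of_real (J p \<bullet> b) * D b u + of_real (J u \<bullet> b) * \<gamma> p b)) (at p)"
    by (rule has_derivative_transform_within_open[OF _ U]) (simp add: linear_form_expand lin)
  have "((\<lambda>x. \<Sum>b\<in>Basis. of_real (J p \<bullet> b) * \<gamma> x b) has_derivative
      (\<lambda>u. \<Sum>b\<in>Basis. of_real (J p \<bullet> b) * D b u)) (at p)"
    by (intro has_derivative_sum has_derivative_mult_right D)
  then have "((\<lambda>x. \<gamma> x (J p)) has_derivative
      (\<lambda>u. \<Sum>b\<in>Basis. of_real (J p \<bullet> b) * D b u)) (at p)"
    by (rule has_derivative_transform_within_open[OF _ U]) (simp add: linear_form_expand lin)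
  then have "frechet_derivative (\<lambda>x. \<gamma> x (J p)) (at p) =
      (\<lambda>u. \<Sum>b\<in>Basis. of_real (J p \<bullet> b) * D b u)"
    by (rule frechet_derivative_at[symmetric])
  with 1 show ?thesis
    by (simp add: sum.distrib linear_form_expand lin U)
qed

text \<open>
  A tangent vector is the velocity of a great circle, along which \<open>g\<close> vanishes.
\<close>

lemma derivative_tangent_zero:
  fixes g :: "complex2 \<Rightarrow> complex"
  assumes p: "p \<in> S3" and u: "u \<in> tangent_S3 p"
    and g: "(g has_derivative g') (at p)" and zero: "\<And>x. x \<in> S3 \<Longrightarrow> g x = 0"
  shows "g' u = 0"
proof (cases "u = 0")
  case True
  then show ?thesis using linear_0[OF bounded_linear.linear[OF has_derivative_bounded_linear[OF g]]] by simp
next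
  case False
  define w where "w = sgn u"
  define c where "c t = cos t *\<^sub>R p + sin t *\<^sub>R w" for t
  have w: "norm w = 1" "p \<bullet> w = 0" "norm p = 1"
    using False u p by (auto simp: w_def norm_sgn sgn_div_norm tangent_S3_def)
  have c: "c t \<in> S3" for t
  proof -
    have "c t \<bullet> c t = (cos t)\<^sup>2 * (p \<bullet> p) + (sin t)\<^sup>2 * (w \<bullet> w) + 2 * (cos t * sin t) * (p \<bullet> w)"
      by (simp add: c_def inner_add_left inner_add_right inner_commute power2_eq_square algebra_simps)
    also have "\<dots> = 1" using w by (simp add: norm_eq_1)
    finally show ?thesis by (simp add: norm_eq_1)
  qed
  have "(c has_derivative (\<lambda>t. t *\<^sub>R w)) (at 0)"
    unfolding c_def by (auto intro!: derivative_eq_intros)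
  moreover have "c 0 = p" by (simp add: c_def)
  ultimately have "((\<lambda>t. g (c t)) has_derivative (\<lambda>t. g' (t *\<^sub>R w))) (at 0)"
    using g has_derivative_compose[of c "\<lambda>t. t *\<^sub>R w" 0 UNIV g g'] by simp
  then have "((\<lambda>t. 0) has_derivative (\<lambda>t. g' (t *\<^sub>R w))) (at (0::real))"
    using zero c by simp
  then have "(\<lambda>t::real. g' (t *\<^sub>R w)) = (\<lambda>t. 0)"
    by (rule has_derivative_unique[OF _ has_derivative_const])
  from fun_cong[OF this, of "norm u"] have "g' (norm u *\<^sub>R w) = 0" .
  then show ?thesis using False by (simp add: w_def sgn_div_norm)
qed

text \<open>
  Exterior differentiation commutes with restriction to the sphere.  A vector \<open>b\<close> tangent at \<open>p\<close>
  extends to the infinitesimal rotation \<open>J x = (x \<bullet> p) b - (x \<bullet> b) p\<close>, which is tangent to the sphere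
  everywhere, so \<open>\<gamma>(J)\<close> vanishes on the sphere.  Differentiating along \<open>a\<close> gives
  \<open>(\<partial>\<^sub>a \<gamma>)(b) = (a \<bullet> b) \<gamma>\<^sub>p(p)\<close>, which is symmetric in \<open>a\<close> and \<open>b\<close> and so drops out of \<open>d\<gamma>(a, b)\<close>.
\<close>

lemma ext_deriv_tangent_zero:
  fixes \<gamma> :: form1
  assumes U: "open U" "S3 \<subseteq> U" and lin: "\<And>x. x \<in> U \<Longrightarrow> linear (\<gamma> x)"
    and d: "\<And>x v. x \<in> U \<Longrightarrow> (\<lambda>x. \<gamma> x v) differentiable (at x)"
    and zero: "\<And>x v. x \<in> S3 \<Longrightarrow> v \<in> tangent_S3 x \<Longrightarrow> \<gamma> x v = 0"
    and p: "p \<in> S3" and u: "u \<in> tangent_S3 p" and v: "v \<in> tangent_S3 p"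
  shows "ext_deriv \<gamma> p u v = 0"
proof -
  have pU: "p \<in> U" using U p by auto
  have np: "p \<bullet> p = 1" using p by (simp add: norm_eq_1)
  have *: "frechet_derivative (\<lambda>x. \<gamma> x b) (at p) a = \<gamma> p ((a \<bullet> b) *\<^sub>R p)"
    if a: "a \<in> tangent_S3 p" and b: "b \<in> tangent_S3 p" for a b
  proof -
    define J where "J x = (x \<bullet> p) *\<^sub>R b - (x \<bullet> b) *\<^sub>R p" for x
    have J: "bounded_linear J"
      unfolding J_def by (intro bounded_linear_sub bounded_linear_scaleR_const bounded_linear_inner_left)
    have Jp: "J p = b" using b np by (simp add: J_def tangent_S3_def)
    have "a \<bullet> p = 0" using a by (simp add: tangent_S3_def inner_commute)
    then have Ja: "J a = - ((a \<bullet> b) *\<^sub>R p)" by (simp add: J_def)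
    have "\<gamma> x (J x) = 0" if "x \<in> S3" for x
      by (rule zero[OF that]) (simp add: tangent_S3_def J_def inner_diff_right inner_commute)
    from derivative_tangent_zero[OF p a has_derivative_form_linear_field[OF U(1) pU lin d[OF pU] J] this]
    have "frechet_derivative (\<lambda>x. \<gamma> x b) (at p) a + \<gamma> p (J a) = 0" by (simp add: Jp)
    then show ?thesis using linear_neg[OF lin[OF pU]] by (simp add: Ja)
  qed
  show ?thesis
    unfolding ext_deriv_def using *[OF u v] *[OF v u] by (simp add: inner_commute)
qed

lemma ext_deriv_combination:
  fixes \<alpha> \<beta> \<omega> :: form1 and f :: "complex2 \<Rightarrow> complex"
  assumes "\<And>v. (\<lambda>x. \<alpha> x v) differentiable (at p)" "\<And>v. (\<lambda>x. \<beta> x v) differentiable (at p)"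
    and "\<And>v. (\<lambda>x. \<omega> x v) differentiable (at p)" "f differentiable (at p)"
  shows "ext_deriv (\<lambda>x v. \<alpha> x v - \<beta> x v - f x * \<omega> x v) p u v =
    ext_deriv \<alpha> p u v - ext_deriv \<beta> p u v -
    (frechet_derivative f (at p) u * \<omega> p v - frechet_derivative f (at p) v * \<omega> p u + f p * ext_deriv \<omega> p u v)"
proof -
  have "frechet_derivative (\<lambda>x. \<alpha> x b - \<beta> x b - f x * \<omega> x b) (at p) a =
      frechet_derivative (\<lambda>x. \<alpha> x b) (at p) a - frechet_derivative (\<lambda>x. \<beta> x b) (at p) a -
      (f p * frechet_derivative (\<lambda>x. \<omega> x b) (at p) a + frechet_derivative f (at p) a * \<omega> p b)" for a b
    by (simp only: frechet_derivative_diff[OF differentiable_diff[OF assms(1,2)] differentiable_mult[OF assms(4,3)]]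
        frechet_derivative_diff[OF assms(1,2)] frechet_derivative_mult[OF assms(4,3)])
  then show ?thesis unfolding ext_deriv_def by (simp add: algebra_simps)
qed

text \<open>
  The algebra behind the independence of the choice of \<open>\<alpha>\<close>, with \<open>\<phi>\<close> in the role of \<open>df\<close>.  Expanding
  \<open>(\<alpha>' + c \<omega>) \<and> (d\<alpha>' + \<phi> \<and> \<omega> + c d\<omega>)\<close>, the terms with two factors \<open>\<omega>\<close> vanish; \<open>\<omega> \<and> d\<omega>\<close> and
  \<open>\<alpha>' \<and> d\<omega>\<close> vanish because \<open>d\<omega> = \<alpha>' \<and> \<omega>\<close>, and \<open>\<omega> \<and> d\<alpha>'\<close> by hypothesis.  What remains beside
  \<open>\<alpha>' \<and> d\<alpha>'\<close> is \<open>\<alpha>' \<and> \<phi> \<and> \<omega> = - \<phi> \<and> d\<omega>\<close>.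
\<close>

lemma wedge12_change_of_connection:
  assumes a: "\<And>x. x \<in> {u, v, w} \<Longrightarrow> \<alpha> p x = \<alpha>' p x + c * \<omega> p x"
    and da: "\<And>x y. x \<in> {u, v, w} \<Longrightarrow> y \<in> {u, v, w} \<Longrightarrow>
      ext_deriv \<alpha> p x y = ext_deriv \<alpha>' p x y + (\<phi> x * \<omega> p y - \<phi> y * \<omega> p x + c * ext_deriv \<omega> p x y)"
    and dw: "\<And>x y. x \<in> {u, v, w} \<Longrightarrow> y \<in> {u, v, w} \<Longrightarrow>
      ext_deriv \<omega> p x y = wedge11 \<alpha>' \<omega> p x y"
    and closed: "wedge12 \<omega> (ext_deriv \<alpha>') p u v w = 0"
  shows "wedge12 \<alpha> (ext_deriv \<alpha>) p u v w =
    wedge12 \<alpha>' (ext_deriv \<alpha>') p u v w - wedge12 (\<lambda>_. \<phi>) (ext_deriv \<omega>) p u v w"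
proof -
  have a3: "\<alpha> p u = \<alpha>' p u + c * \<omega> p u" "\<alpha> p v = \<alpha>' p v + c * \<omega> p v" "\<alpha> p w = \<alpha>' p w + c * \<omega> p w"
    by (rule a, simp)+
  note da3 = da[of u v] da[of u w] da[of v w] and dw3 = dw[of u v] dw[of u w] dw[of v w]
  show ?thesis
    using a3 da3 dw3 closed unfolding wedge12_def wedge11_def insert_iff simp_thms by algebra
qed

section \<open>Rotation invariance of the sphere measure\<close>

text \<open>
  By Fubini a shear only translates the slices.
\<close>

lemma distr_lborel_shear_fst:
  fixes L :: "'b::euclidean_space \<Rightarrow> 'a::euclidean_space"
  assumes [measurable]: "L \<in> borel_measurable borel"
  shows "distr lborel borel (\<lambda>p. (fst p + L (snd p), snd p)) = lborel"
proof (rule measure_eqI)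
  fix A :: "('a \<times> 'b) set" assume "A \<in> sets (distr lborel borel (\<lambda>p. (fst p + L (snd p), snd p)))"
  then have [measurable]: "A \<in> sets borel" by simp
  have A2: "A \<in> sets (lborel \<Otimes>\<^sub>M lborel)" unfolding lborel_prod by simp
  have m[measurable]: "(\<lambda>p::'a\<times>'b. (fst p + L (snd p), snd p)) \<in> borel \<rightarrow>\<^sub>M borel"
    by (simp add: borel_prod[symmetric])
  let ?B = "(\<lambda>p. (fst p + L (snd p), snd p)) -` A"
  have B: "?B \<in> sets (borel)" using measurable_sets[OF m, of A] by simp
  then have B2: "?B \<in> sets (lborel \<Otimes>\<^sub>M lborel)" unfolding lborel_prod by simp
  have sl: "emeasure lborel ((\<lambda>x. (x, y)) -` ?B) = emeasure lborel ((\<lambda>x. (x, y)) -` A)" for y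
  proof -
    have s: "(\<lambda>x. (x, y)) -` A \<in> sets (borel :: 'a measure)"
      using sets_Pair2[OF A2] by simp
    have "emeasure lborel ((\<lambda>x. (x, y)) -` A) =
       emeasure (distr lborel borel ((+) (L y))) ((\<lambda>x. (x, y)) -` A)"
      by (simp add: lborel_distr_plus)
    also have "\<dots> = emeasure lborel ((\<lambda>x. (x, y)) -` ?B)"
      using s by (subst emeasure_distr) (auto intro!: arg_cong[where f="emeasure lborel"] simp: add.commute)
    finally show ?thesis by simp
  qed
  have "emeasure (distr lborel borel (\<lambda>p. (fst p + L (snd p), snd p))) A = emeasure (lborel \<Otimes>\<^sub>M lborel) ?B"
    by (simp add: emeasure_distr lborel_prod)
  also have "\<dots> = emeasure (lborel \<Otimes>\<^sub>M lborel) A"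
    by (simp add: lborel_pair.emeasure_pair_measure_alt2[OF A2] lborel_pair.emeasure_pair_measure_alt2[OF B2] sl)
  finally show "emeasure (distr lborel borel (\<lambda>p. (fst p + L (snd p), snd p))) A = emeasure lborel A"
    by (simp add: lborel_prod)
qed simp

lemma distr_lborel_shear_snd:
  fixes L :: "'a::euclidean_space \<Rightarrow> 'b::euclidean_space"
  assumes [measurable]: "L \<in> borel_measurable borel"
  shows "distr lborel borel (\<lambda>p. (fst p, snd p + L (fst p))) = lborel"
proof (rule measure_eqI)
  fix A :: "('a \<times> 'b) set" assume "A \<in> sets (distr lborel borel (\<lambda>p. (fst p, snd p + L (fst p))))"
  then have [measurable]: "A \<in> sets borel" by simp
  have A2: "A \<in> sets (lborel \<Otimes>\<^sub>M lborel)" unfolding lborel_prod by simp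
  have m[measurable]: "(\<lambda>p::'a\<times>'b. (fst p, snd p + L (fst p))) \<in> borel \<rightarrow>\<^sub>M borel"
    by (simp add: borel_prod[symmetric])
  let ?B = "(\<lambda>p. (fst p, snd p + L (fst p))) -` A"
  have B: "?B \<in> sets (borel)" using measurable_sets[OF m, of A] by simp
  then have B2: "?B \<in> sets (lborel \<Otimes>\<^sub>M lborel)" unfolding lborel_prod by simp
  have sl: "emeasure lborel (Pair x -` ?B) = emeasure lborel (Pair x -` A)" for x
  proof -
    have s: "Pair x -` A \<in> sets (borel :: 'b measure)"
      using sets_Pair1[OF A2] by simp
    have "emeasure lborel (Pair x -` A) = emeasure (distr lborel borel ((+) (L x))) (Pair x -` A)"
      by (simp add: lborel_distr_plus)
    also have "\<dots> = emeasure lborel (Pair x -` ?B)"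
      using s by (subst emeasure_distr) (auto intro!: arg_cong[where f="emeasure lborel"] simp: add.commute)
    finally show ?thesis by simp
  qed
  have "emeasure (distr lborel borel (\<lambda>p. (fst p, snd p + L (fst p)))) A = emeasure (lborel \<Otimes>\<^sub>M lborel) ?B"
    by (simp add: emeasure_distr lborel_prod)
  also have "\<dots> = emeasure (lborel \<Otimes>\<^sub>M lborel) A"
    by (simp add: lborel.emeasure_pair_measure_alt[OF A2] lborel.emeasure_pair_measure_alt[OF B2] sl)
  finally show "emeasure (distr lborel borel (\<lambda>p. (fst p, snd p + L (fst p)))) A = emeasure lborel A"
    by (simp add: lborel_prod)
qed simp

text \<open>
  For \<open>\<bar>c\<bar> = 1\<close> this is a complex structure on \<open>\<real>\<^sup>4\<close> that anticommutes with the standard one; the fields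
  \<open>frame2\<close> and \<open>frame3\<close> are the cases \<open>c = 1\<close> and \<open>c = \<i>\<close>.  The rotations below are its flow.
\<close>

definition quarter_turn :: "complex \<Rightarrow> complex2 \<Rightarrow> complex2" where
  "quarter_turn c p = (- c * cnj (snd p), c * cnj (fst p))"

definition rotate_by :: "complex \<Rightarrow> real \<Rightarrow> complex2 \<Rightarrow> complex2" where
  "rotate_by c t p = cos t *\<^sub>R p + sin t *\<^sub>R quarter_turn c p"

lemma bounded_linear_quarter_turn: "bounded_linear (quarter_turn c)"
  unfolding quarter_turn_def
  by (intro bounded_linear_Pair bounded_linear_const_mult bounded_linear_compose[OF bounded_linear_cnj]
      bounded_linear_fst bounded_linear_snd)

lemma unit_mult_cnj: "norm c = 1 \<Longrightarrow> c * cnj c = 1"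
  by (simp add: complex_norm_square[symmetric])

lemma quarter_turn_twice:
  assumes "norm c = 1"
  shows "quarter_turn c (quarter_turn c p) = - p"
proof -
  have *: "c * (cnj c * z) = z" for z
    using unit_mult_cnj[OF assms] by (simp add: mult.assoc[symmetric])
  show ?thesis by (cases p) (simp add: quarter_turn_def *)
qed

lemma bounded_linear_rotate_by: "bounded_linear (rotate_by c t)"
  unfolding rotate_by_def
  by (intro bounded_linear_add bounded_linear_scaleR_right[THEN bounded_linear_compose]
      bounded_linear_quarter_turn bounded_linear_ident)

lemma norm_rotate_by:
  assumes "norm c = 1"
  shows "norm (rotate_by c t p) = norm p"
proof -
  have 1: "p \<bullet> quarter_turn c p = 0"
    by (cases p) (simp add: quarter_turn_def inner_complex_def algebra_simps)
  have "norm (quarter_turn c p) = norm p"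
    using assms by (cases p) (simp add: quarter_turn_def norm_Pair norm_mult add.commute)
  then have 2: "quarter_turn c p \<bullet> quarter_turn c p = p \<bullet> p"
    by (simp add: norm_eq)
  have "rotate_by c t p \<bullet> rotate_by c t p = (cos t * cos t + sin t * sin t) * (p \<bullet> p)"
    unfolding rotate_by_def
    by (simp add: inner_add_left inner_add_right inner_commute[of "quarter_turn c p" p] 1 2 distrib_right
        del: sin_cos_squared_add3)
  also have "\<dots> = p \<bullet> p" by simp
  finally have "rotate_by c t p \<bullet> rotate_by c t p = p \<bullet> p" .
  then show ?thesis by (simp add: norm_eq)
qed

text \<open>
  The decomposition of a plane rotation into three shears.  It makes the invariance of Lebesgue measure
  under these rotations a consequence of its translation invariance.
\<close>

lemma rotate_by_eq_shears:
  assumes c: "norm c = 1" and t: "1 + cos t \<noteq> 0"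
  defines "\<tau> \<equiv> sin t / (1 + cos t)"
  defines "A \<equiv> \<lambda>p::complex2. (fst p + (\<lambda>y. - (\<tau> *\<^sub>R (c * cnj y))) (snd p), snd p)"
  defines "B \<equiv> \<lambda>p::complex2. (fst p, snd p + (\<lambda>x. sin t *\<^sub>R (c * cnj x)) (fst p))"
  shows "rotate_by c t p = A (B (A p))"
proof -
  obtain z w where p: "p = (z, w)" by (cases p)
  define s C T :: complex where "s = of_real (sin t)" and "C = of_real (cos t)" and "T = of_real \<tau>"
  (* tau is tan (t / 2) *)
  have "sin t * \<tau> = (1 - cos t)"
  proof -
    have "sin t * sin t = (1 - cos t) * (1 + cos t)"
      using sin_cos_squared_add[of t] by (simp add: power2_eq_square algebra_simps)
    then show ?thesis using t by (simp add: \<tau>_def field_simps)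
  qed
  then have r1: "s * T = 1 - C" unfolding s_def C_def T_def by (metis of_real_1 of_real_diff of_real_mult)
  have "\<tau> * (1 + cos t) = sin t" using t by (simp add: \<tau>_def)
  then have r2: "T * (1 + C) = s" unfolding s_def C_def T_def by (metis of_real_1 of_real_add of_real_mult)
  have cc: "c * cnj c = 1" by (rule unit_mult_cnj[OF c])
  have real: "cnj s = s" "cnj T = T" by (simp_all add: s_def T_def)
  have "C * w + s * (c * cnj z) = w + s * (c * cnj (z - T * (c * cnj w)))"
    using r1 cc by (simp add: real) algebra
  moreover have "C * z - s * (c * cnj w) = (z - T * (c * cnj w)) - T * (c * cnj (w + s * (c * cnj (z - T * (c * cnj w)))))"
    using r1 r2 cc by (simp add: real) algebra
  ultimately show ?thesis
    by (simp add: p rotate_by_def quarter_turn_def A_def B_def scaleR_conv_of_real s_def C_def T_def)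
qed

lemma distr_lborel_rotate_by:
  assumes c: "norm c = 1" and t: "1 + cos t \<noteq> 0"
  shows "distr lborel borel (rotate_by c t) = lborel"
proof -
  define \<tau> where "\<tau> = sin t / (1 + cos t)"
  define A where "A = (\<lambda>p::complex2. (fst p + (\<lambda>y. - (\<tau> *\<^sub>R (c * cnj y))) (snd p), snd p))"
  define B where "B = (\<lambda>p::complex2. (fst p, snd p + (\<lambda>x. sin t *\<^sub>R (c * cnj x)) (fst p)))"
  have L: "(\<lambda>y. - (\<tau> *\<^sub>R (c * cnj y))) \<in> borel_measurable borel"
     "(\<lambda>x. sin t *\<^sub>R (c * cnj x)) \<in> borel_measurable borel"
    by (auto intro!: borel_measurable_continuous_onI continuous_intros)
  have dA: "distr lborel borel A = lborel" unfolding A_def by (rule distr_lborel_shear_fst[OF L(1)])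
  have dB: "distr lborel borel B = lborel" unfolding B_def by (rule distr_lborel_shear_snd[OF L(2)])
  have [measurable]: "A \<in> borel \<rightarrow>\<^sub>M borel" "B \<in> borel \<rightarrow>\<^sub>M borel"
    unfolding A_def B_def by (auto intro!: borel_measurable_continuous_onI continuous_intros)
  have "rotate_by c t = A \<circ> (B \<circ> A)"
    using rotate_by_eq_shears[OF c t] unfolding A_def B_def \<tau>_def by fastforce
  then have "distr lborel borel (rotate_by c t) = distr (distr (distr lborel borel A) borel B) borel A"
    by (simp add: distr_distr)
  then show ?thesis by (simp add: dA dB)
qed

lemma sets_sphere_measure [simp, measurable_cong]: "sets sphere_measure = sets borel"
  by (simp add: sphere_measure_def)

lemma space_sphere_measure [simp]: "space sphere_measure = UNIV"
  by (simp add: sphere_measure_def)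

lemma emeasure_sphere_measure:
  fixes A :: "'a::euclidean_space set"
  assumes A: "A \<in> sets borel"
  shows "emeasure sphere_measure A = ennreal (real DIM('a)) * emeasure lborel (sgn -` A \<inter> ball 0 1)"
proof -
  have m: "sgn \<in> borel_measurable (borel :: 'a measure)"
    unfolding sgn_div_norm by measurable
  have m': "sgn \<in> restrict_space lborel (ball (0::'a) 1) \<rightarrow>\<^sub>M borel"
    by (rule measurable_restrict_space1) (simp add: m)
  have "emeasure sphere_measure A = (\<integral>\<^sup>+x. ennreal (real DIM('a)) * indicator A x \<partial>distr (restrict_space lborel (ball (0::'a) 1)) borel sgn)"
    unfolding sphere_measure_def using A by (subst emeasure_density) auto
  also have "\<dots> = ennreal (real DIM('a)) * emeasure (distr (restrict_space lborel (ball (0::'a) 1)) borel sgn) A"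
    using A by (subst nn_integral_cmult_indicator) auto
  also have "emeasure (distr (restrict_space lborel (ball (0::'a) 1)) borel sgn) A = emeasure (restrict_space lborel (ball (0::'a) 1)) (sgn -` A \<inter> ball 0 1)"
    using A m' by (subst emeasure_distr) (auto simp: space_restrict_space)
  also have "\<dots> = emeasure lborel (sgn -` A \<inter> ball 0 1)"
    by (subst emeasure_restrict_space) auto
  finally show ?thesis .
qed

lemma finite_measure_sphere_measure: "finite_measure (sphere_measure :: 'a::euclidean_space measure)"
proof
  have "emeasure lborel (sgn -` UNIV \<inter> ball (0::'a) 1) < \<infinity>"
    using emeasure_lborel_ball_finite by simp
  then show "emeasure sphere_measure (space (sphere_measure :: 'a measure)) \<noteq> \<infinity>"
    by (simp add: emeasure_sphere_measure ennreal_mult_eq_top_iff)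
qed

text \<open>
  The cone over the sphere is the punctured unit ball, of volume \<open>\<pi>\<^sup>2 / 2\<close>.
\<close>

lemma measure_sphere_measure_S3: "measure sphere_measure S3 = 2 * pi\<^sup>2"
proof -
  have "sgn -` S3 \<inter> ball 0 1 = ball 0 1 - {0 :: complex2}"
    by (auto simp: norm_sgn)
  moreover have "emeasure lborel (ball 0 1 - {0 :: complex2}) = emeasure lborel (ball (0::complex2) 1)"
    by (subst emeasure_Diff) auto
  ultimately have "emeasure sphere_measure S3 = ennreal 4 * emeasure lborel (ball (0::complex2) 1)"
    by (subst emeasure_sphere_measure) (auto)
  also have "\<dots> = ennreal (4 * (pi\<^sup>2 / 2))"
    by (subst ennreal_mult) (auto simp: emeasure_ball unit_ball_vol_4)
  finally show ?thesis by (simp add: measure_def)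
qed

text \<open>
  Rotations commute with the radial projection \<open>sgn\<close> and preserve the ball and Lebesgue measure.
\<close>

lemma distr_sphere_measure_rotate_by:
  assumes c: "norm c = 1" and t: "1 + cos t \<noteq> 0"
  shows "distr sphere_measure borel (rotate_by c t) = sphere_measure"
proof (rule measure_eqI)
  fix A assume "A \<in> sets (distr sphere_measure borel (rotate_by c t))"
  then have A: "A \<in> sets borel" by simp
  have R[measurable]: "rotate_by c t \<in> borel \<rightarrow>\<^sub>M borel"
    by (intro borel_measurable_continuous_onI linear_continuous_on bounded_linear_rotate_by)
  have RA: "rotate_by c t -` A \<in> sets borel" using measurable_sets[OF R A] by simp
  have m: "sgn \<in> borel_measurable (borel :: complex2 measure)"
    unfolding sgn_div_norm by measurable
  have sA: "sgn -` A \<inter> ball 0 1 \<in> sets borel" using measurable_sets[OF m A] by simp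
  have sg: "sgn (rotate_by c t x) = rotate_by c t (sgn x)" for x
    using linear_scale[OF bounded_linear.linear[OF bounded_linear_rotate_by]]
    by (simp add: sgn_div_norm norm_rotate_by[OF c])
  have "emeasure (distr sphere_measure borel (rotate_by c t)) A = emeasure sphere_measure (rotate_by c t -` A)"
    using A by (subst emeasure_distr) auto
  also have "\<dots> = ennreal (real DIM(complex2)) * emeasure lborel (sgn -` (rotate_by c t -` A) \<inter> ball 0 1)"
    by (rule emeasure_sphere_measure[OF RA])
  also have "sgn -` (rotate_by c t -` A) \<inter> ball 0 1 = rotate_by c t -` (sgn -` A \<inter> ball 0 1)"
    by (simp add: set_eq_iff sg norm_rotate_by[OF c])
  also have "emeasure lborel \<dots> = emeasure (distr lborel borel (rotate_by c t)) (sgn -` A \<inter> ball 0 1)"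
    using sA by (subst emeasure_distr) auto
  also have "ennreal (real DIM(complex2)) * \<dots> = emeasure sphere_measure A"
    unfolding distr_lborel_rotate_by[OF c t] by (rule emeasure_sphere_measure[OF A, symmetric])
  finally show "emeasure (distr sphere_measure borel (rotate_by c t)) A = emeasure sphere_measure A" .
qed simp

lemma continuous_on_S3_bounded:
  fixes h :: "complex2 \<Rightarrow> complex"
  assumes "continuous_on S3 h"
  shows "\<exists>B. \<forall>x\<in>S3. norm (h x) \<le> B"
  using compact_imp_bounded[OF compact_continuous_image[OF assms compact_sphere]]
  unfolding bounded_iff by blast

lemma set_integrable_S3_continuous:
  fixes h :: "complex2 \<Rightarrow> complex"
  assumes "continuous_on S3 h"
  shows "set_integrable sphere_measure S3 h"
proof -
  obtain B where B: "\<And>x. x \<in> S3 \<Longrightarrow> norm (h x) \<le> B"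
    using continuous_on_S3_bounded[OF assms] by blast
  interpret finite_measure "sphere_measure :: complex2 measure" by (rule finite_measure_sphere_measure)
  show ?thesis unfolding set_integrable_def
  proof (rule integrable_const_bound[where B = "max B 0"])
    show "(\<lambda>x. indicat_real S3 x *\<^sub>R h x) \<in> borel_measurable sphere_measure"
      using borel_measurable_continuous_on_indicator[OF _ assms] 
      by (simp add: measurable_cong_sets[OF sets_sphere_measure refl])
    show "AE x in sphere_measure. norm (indicat_real S3 x *\<^sub>R h x) \<le> max B 0"
    proof (rule AE_I2)
      show "norm (indicat_real S3 x *\<^sub>R h x) \<le> max B 0" for x
        using B[of x] by (cases "x \<in> S3") (simp_all add: max.coboundedI1)
    qed
  qed
qed

text \<open>
  The case of Stokes' theorem that is needed.  The integral of \<open>g\<close> composed with a rotation does not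
  depend on the angle, so its difference quotients vanish; dominated convergence, with the bound from
  the mean value inequality along an orbit, passes to the limit under the integral.
\<close>

lemma integral_rotation_derivative:
  fixes g :: "complex2 \<Rightarrow> complex"
  assumes c: "norm c = 1" and U: "open U" "S3 \<subseteq> U" and g: "Ck_on 1 U g"
  shows "(LINT p:S3|sphere_measure. frechet_derivative g (at p) (quarter_turn c p)) = 0"
proof -
  define h where "h p = frechet_derivative g (at p) (quarter_turn c p)" for p
  define t where "t k = 1 / real (Suc k)" for k
  have t01: "0 < t k" "t k \<le> 1" for k by (auto simp: t_def)
  have cos: "1 + cos (t k) \<noteq> 0" for k
    using cos_gt_zero_pi[of "t k"] t01[of k] pi_gt3 by force
  have h: "continuous_on S3 h"
    unfolding h_def
    by (rule continuous_on_subset[OF continuous_on_frechet_derivative_along[OF g] U(2)])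
      (rule linear_continuous_on[OF bounded_linear_quarter_turn])
  have gc: "continuous_on S3 g"
    using Ck_on_SucD[of 0 U g] g U(2) continuous_on_subset by auto
  have R: "rotate_by c s p \<in> S3 \<longleftrightarrow> p \<in> S3" for s p by (simp add: norm_rotate_by[OF c])
  obtain B where B: "\<And>x. x \<in> S3 \<Longrightarrow> norm (h x) \<le> B"
    using continuous_on_S3_bounded[OF h] by blast
  (* The quarter turn squares to -1, so the orbits are integral curves of its vector field. *)
  have dR: "((\<lambda>s. g (rotate_by c s p)) has_derivative (\<lambda>x. x *\<^sub>R h (rotate_by c s p))) (at s)"
    if "p \<in> S3" for p s
  proof -
    let ?q = "rotate_by c s p"
    have "?q \<in> U" using U(2) R[of s p] that by blast
    then have gd: "g differentiable (at ?q)" using g by simp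
    then have "(g has_derivative frechet_derivative g (at ?q)) (at ?q)"
      by (simp add: frechet_derivative_works[symmetric])
    moreover have "((\<lambda>s. rotate_by c s p) has_derivative (\<lambda>x. x *\<^sub>R quarter_turn c ?q)) (at s)"
    proof -
      have l: "linear (quarter_turn c)" using bounded_linear_quarter_turn bounded_linear.linear by blast
      have eq: "quarter_turn c ?q = cos s *\<^sub>R quarter_turn c p - sin s *\<^sub>R p"
        by (simp add: rotate_by_def linear_add[OF l] linear_scale[OF l] quarter_turn_twice[OF c])
      show ?thesis unfolding eq unfolding rotate_by_def
        by (auto intro!: derivative_eq_intros simp: algebra_simps)
    qed
    ultimately have "((\<lambda>s. g (rotate_by c s p)) has_derivative
        (\<lambda>x. frechet_derivative g (at ?q) (x *\<^sub>R quarter_turn c ?q))) (at s)"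
      using has_derivative_compose by blast
    moreover have "linear (frechet_derivative g (at ?q))"
      by (rule linear_frechet_derivative[OF gd])
    ultimately show ?thesis by (simp add: h_def linear_scale)
  qed
  have R0: "rotate_by c 0 p = p" for p by (simp add: rotate_by_def)
  have bound: "norm (g (rotate_by c s p) - g p) \<le> B * s" if "p \<in> S3" "0 \<le> s" for p s
  proof -
    have "norm (g (rotate_by c s p) - g (rotate_by c 0 p)) \<le> B * norm (s - 0)"
    proof (rule differentiable_bound[where S = UNIV])
      show "((\<lambda>s. g (rotate_by c s p)) has_derivative (\<lambda>x. x *\<^sub>R h (rotate_by c r p))) (at r within UNIV)" for r
        using dR[OF that(1)] by simp
      show "onorm (\<lambda>x. x *\<^sub>R h (rotate_by c r p)) \<le> B" for r
        using B[of "rotate_by c r p"] R[of r p] that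
        by (intro onorm_le) (auto simp: mult.commute[of B] intro!: mult_left_mono)
    qed auto
    then show ?thesis using that by (simp add: R0)
  qed
  define F where "F k p = indicat_real S3 p *\<^sub>R ((g (rotate_by c (t k) p) - g p) /\<^sub>R t k)" for k p
  have intR: "integrable sphere_measure (\<lambda>p. indicat_real S3 p *\<^sub>R g (rotate_by c s p))" for s
  proof -
    have "continuous_on S3 (\<lambda>p. g (rotate_by c s p))"
      by (rule continuous_on_compose2[OF gc linear_continuous_on[OF bounded_linear_rotate_by]]) (auto simp: norm_rotate_by[OF c])
    then show ?thesis using set_integrable_S3_continuous unfolding set_integrable_def by blast
  qed
  have intg: "integrable sphere_measure (\<lambda>p. indicat_real S3 p *\<^sub>R g p)" using intR[of 0] by (simp add: R0)
  have eqR: "(LINT p|sphere_measure. indicat_real S3 p *\<^sub>R g (rotate_by c (t k) p)) =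
      (LINT p|sphere_measure. indicat_real S3 p *\<^sub>R g p)" for k
  proof -
    have m: "(\<lambda>p. indicat_real S3 p *\<^sub>R g p) \<in> borel_measurable borel"
      using borel_measurable_continuous_on_indicator[OF _ gc] by simp
    have mR: "rotate_by c (t k) \<in> sphere_measure \<rightarrow>\<^sub>M borel"
      using borel_measurable_continuous_onI[OF linear_continuous_on[OF bounded_linear_rotate_by]] 
      by (simp add: measurable_cong_sets[OF sets_sphere_measure refl])
    have "(LINT p|sphere_measure. indicat_real S3 p *\<^sub>R g p) =
        (LINT p|distr sphere_measure borel (rotate_by c (t k)). indicat_real S3 p *\<^sub>R g p)"
      by (simp add: distr_sphere_measure_rotate_by[OF c cos])
    also have "\<dots> = (LINT p|sphere_measure. indicat_real S3 (rotate_by c (t k) p) *\<^sub>R g (rotate_by c (t k) p))"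
      by (rule integral_distr[OF mR m])
    also have "\<dots> = (LINT p|sphere_measure. indicat_real S3 p *\<^sub>R g (rotate_by c (t k) p))"
      by (simp add: indicator_def norm_rotate_by[OF c])
    finally show ?thesis by simp
  qed
  have F_eq: "F k = (\<lambda>p. (indicat_real S3 p *\<^sub>R g (rotate_by c (t k) p) - indicat_real S3 p *\<^sub>R g p) /\<^sub>R t k)" for k
    by (auto simp: F_def indicator_def)
  have F_int: "integrable sphere_measure (F k)" for k
    unfolding F_eq by (intro integrable_scaleR_right Bochner_Integration.integrable_diff intR intg)
  have F0: "(LINT p|sphere_measure. F k p) = 0" for k
    unfolding F_eq by (simp add: Bochner_Integration.integral_diff[OF intR intg] eqR)
  interpret finite_measure "sphere_measure :: complex2 measure" by (rule finite_measure_sphere_measure)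
  have "(\<lambda>k. LINT p|sphere_measure. F k p) \<longlonglongrightarrow> (LINT p|sphere_measure. indicat_real S3 p *\<^sub>R h p)"
  proof (rule integral_dominated_convergence[where w = "\<lambda>_. max B 0"])
    show "(\<lambda>p. indicat_real S3 p *\<^sub>R h p) \<in> borel_measurable sphere_measure"
      using set_integrable_S3_continuous[OF h] unfolding set_integrable_def by auto
    show "F k \<in> borel_measurable sphere_measure" for k using F_int[of k] by auto
    show "AE p in sphere_measure. norm (F k p) \<le> max B 0" for k
    proof (rule AE_I2)
      fix p
      show "norm (F k p) \<le> max B 0"
      proof (cases "p \<in> S3")
        case True
        have "norm (g (rotate_by c (t k) p) - g p) \<le> B * t k"
          using bound[OF True] t01(1)[of k] by simp
        then have "norm (g (rotate_by c (t k) p) - g p) / t k \<le> B"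
          using t01(1)[of k] by (simp add: pos_divide_le_eq)
        then have "norm (F k p) \<le> B"
          using True t01(1)[of k] by (simp add: F_def divide_inverse mult.commute)
        then show ?thesis by simp
      qed (simp add: F_def)
    qed
    show "AE p in sphere_measure. (\<lambda>k. F k p) \<longlonglongrightarrow> indicat_real S3 p *\<^sub>R h p"
    proof (rule AE_I2)
      fix p
      show "(\<lambda>k. F k p) \<longlonglongrightarrow> indicat_real S3 p *\<^sub>R h p"
      proof (cases "p \<in> S3")
        case True
        have lim: "((\<lambda>s. norm (g (rotate_by c s p) - g p - s *\<^sub>R h p) / norm s) \<longlongrightarrow> 0) (at 0)"
          using dR[OF True, of 0] by (simp add: has_derivative_iff_norm R0)
        have eq: "norm (g (rotate_by c s p) - g p - s *\<^sub>R h p) / norm s =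
            norm ((g (rotate_by c s p) - g p) /\<^sub>R s - h p)" if "s \<noteq> 0" for s
        proof -
          have "(g (rotate_by c s p) - g p) /\<^sub>R s - h p = (g (rotate_by c s p) - g p - s *\<^sub>R h p) /\<^sub>R s"
            using that by (simp add: scaleR_diff_right)
          then show ?thesis by (simp add: divide_inverse mult.commute)
        qed
        have "((\<lambda>s. norm ((g (rotate_by c s p) - g p) /\<^sub>R s - h p)) \<longlongrightarrow> 0) (at 0)"
          by (rule Lim_transform_eventually[OF lim]) (auto simp: eventually_at_filter eq simp del: real_norm_def intro!: always_eventually)
        then have "((\<lambda>s. (g (rotate_by c s p) - g p) /\<^sub>R s) \<longlongrightarrow> h p) (at 0)"
          by (rule LIM_zero_cancel[OF tendsto_norm_zero_cancel])
        moreover have "filterlim t (at 0) sequentially"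
          unfolding filterlim_at using t01(1) LIMSEQ_Suc[OF lim_1_over_n] by (auto simp: t_def[abs_def] less_imp_neq[symmetric])
        ultimately have "(\<lambda>k. (g (rotate_by c (t k) p) - g p) /\<^sub>R t k) \<longlonglongrightarrow> h p"
          by (rule filterlim_compose)
        then show ?thesis using True by (simp add: F_def)
      qed (simp add: F_def)
    qed
  qed auto
  then have "(LINT p|sphere_measure. indicat_real S3 p *\<^sub>R h p) = 0"
    by (simp add: F0 LIMSEQ_const_iff)
  then show ?thesis by (simp add: set_lebesgue_integral_def h_def)
qed


section \<open>The forms \<open>\<omega>\<^sub>n\<close>\<close>

text \<open>
  A form \<open>\<alpha>\<close> of type \<open>(1,0)\<close> whose value on \<open>(n z + w\<^sup>n) \<partial>\<^sub>z + w \<partial>\<^sub>w\<close>, the direction of the kernel of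
  \<open>\<omega>\<^sub>n\<close>, is \<open>(n + 1) (\<bar>z\<bar>\<^sup>2 + \<bar>w\<bar>\<^sup>2)\<close>.  The term with \<open>w\<^bsup>n-1\<^esup>\<close> compensates the contribution of \<open>w\<^sup>n\<close> to
  the pairing of \<open>cnj z / n dz\<close> with that field.
\<close>

definition connection_form :: "nat \<Rightarrow> form1" where
  "connection_form n p v = (of_nat n + 1) *
     (cnj (fst p) / of_nat n * fst v +
      (cnj (snd p) - cnj (fst p) * snd p ^ (n - 1) / of_nat n) * snd v)"

lemma S3_cnj: "(z, w) \<in> S3 \<Longrightarrow> z * cnj z + w * cnj w = 1"
  by (simp add: norm_Pair complex_norm_square[symmetric] flip: of_real_power of_real_add)

lemma linear_omega: "linear (omega n p)"
  by (rule linearI) (simp_all add: omega_def scaleR_conv_of_real algebra_simps)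

lemma linear_connection_form: "linear (connection_form n p)"
  by (rule linearI) (simp_all add: connection_form_def divide_inverse scaleR_conv_of_real algebra_simps)

lemmas bounded_linear_cnj_fst = bounded_linear_compose[OF bounded_linear_cnj bounded_linear_fst]
lemmas bounded_linear_cnj_snd = bounded_linear_compose[OF bounded_linear_cnj bounded_linear_snd]

lemma Ck_on_omega: "open U \<Longrightarrow> Ck_on k U (\<lambda>p. omega n p v)"
  unfolding omega_def
  by (intro Ck_on_add Ck_on_diff Ck_on_mult Ck_on_const Ck_on_power
      Ck_on_bounded_linear bounded_linear_fst bounded_linear_snd)

lemma Ck_on_connection_form: "open U \<Longrightarrow> Ck_on k U (\<lambda>p. connection_form n p v)"
  unfolding connection_form_def divide_inverse
  by (intro Ck_on_add Ck_on_diff Ck_on_mult Ck_on_const Ck_on_power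
      Ck_on_bounded_linear bounded_linear_snd bounded_linear_cnj_fst bounded_linear_cnj_snd)

lemma smooth_omega: "smooth_form1_near_S3 (omega n)"
  unfolding smooth_form1_near_S3_def smooth_on_def
  using linear_omega Ck_on_omega by (intro exI[of _ UNIV]) auto

lemma smooth_connection_form: "smooth_form1_near_S3 (connection_form n)"
  unfolding smooth_form1_near_S3_def smooth_on_def
  using linear_connection_form Ck_on_connection_form by (intro exI[of _ UNIV]) auto

lemma ext_deriv_eq:
  assumes "\<And>v. ((\<lambda>x. \<alpha> x v) has_derivative D v) (at p)"
  shows "ext_deriv \<alpha> p u v = D v u - D u v"
  unfolding ext_deriv_def
  using frechet_derivative_at[OF assms[of u]] frechet_derivative_at[OF assms[of v]] by simp

lemma ext_deriv_omega:
  "ext_deriv (omega n) p u v = (of_nat n + 1) * (fst u * snd v - fst v * snd u)"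
proof -
  have "((\<lambda>x. omega n x v) has_derivative (\<lambda>u. of_nat n * fst u * snd v - snd u * fst v +
      of_nat n * snd u * snd p ^ (n - 1) * snd v)) (at p)" for v
    unfolding omega_def
    by (rule has_derivative_eq_rhs, (rule derivative_intros)+) simp
  from ext_deriv_eq[of "omega n", OF this] show ?thesis by (simp add: algebra_simps)
qed

lemma ext_deriv_omega_frame:
  assumes "p \<in> S3"
  shows "ext_deriv (omega n) p (frame2 p) (frame3 p) = 0"
    and "ext_deriv (omega n) p (frame1 p) (frame3 p) = - (of_nat n + 1)"
    and "ext_deriv (omega n) p (frame1 p) (frame2 p) = (of_nat n + 1) * \<i>"
proof -
  obtain z w where zw: "p = (z, w)" by (cases p)
  have S: "z * cnj z + w * cnj w = 1" using S3_cnj[of z w] assms by (simp add: zw)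
  have "\<i> * z * (\<i> * cnj z) - (- \<i> * cnj w) * (\<i> * w) = - (z * cnj z + w * cnj w)"
    "\<i> * z * cnj z - (- cnj w) * (\<i> * w) = \<i> * (z * cnj z + w * cnj w)"
    using i_squared by (algebra, simp add: algebra_simps)
  then show "ext_deriv (omega n) p (frame2 p) (frame3 p) = 0"
    "ext_deriv (omega n) p (frame1 p) (frame3 p) = - (of_nat n + 1)"
    "ext_deriv (omega n) p (frame1 p) (frame2 p) = (of_nat n + 1) * \<i>"
    unfolding zw ext_deriv_omega frame1_def frame2_def frame3_def fst_conv snd_conv S by simp_all
qed

lemma ext_deriv_connection_form:
  "ext_deriv (connection_form n) p u v = (of_nat n + 1) *
     ((cnj (fst u) * fst v - cnj (fst v) * fst u) / of_nat n + (cnj (snd u) * snd v - cnj (snd v) * snd u)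
      - snd p ^ (n - 1) / of_nat n * (cnj (fst u) * snd v - cnj (fst v) * snd u))"
proof -
  have c: "((\<lambda>p. cnj (fst p)) has_derivative (\<lambda>u. cnj (fst u))) (at p)"
    "((\<lambda>p. cnj (snd p)) has_derivative (\<lambda>u. cnj (snd u))) (at p)"
    by (intro bounded_linear_imp_has_derivative bounded_linear_cnj_fst bounded_linear_cnj_snd)+
  define q :: complex where "q = inverse (of_nat n)"
  have "((\<lambda>x. connection_form n x v) has_derivative (\<lambda>u. (of_nat n + 1) *
     (cnj (fst u) * q * fst v +
      (cnj (snd u) - (cnj (fst p) * (of_nat (n - 1) * snd u * snd p ^ (n - 1 - 1)) + cnj (fst u) * snd p ^ (n - 1)) * q) * snd v))) (at p)" for v
    unfolding connection_form_def divide_inverse q_def[symmetric]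
    by (rule has_derivative_eq_rhs, (rule c derivative_intros)+) simp
  from ext_deriv_eq[of "connection_form n", OF this] show ?thesis
    unfolding divide_inverse q_def[symmetric] by (simp add: algebra_simps)
qed

lemma wedge11_connection_form_omega:
  assumes n: "n \<ge> 1" and p: "p \<in> S3"
  shows "wedge11 (connection_form n) (omega n) p u v = ext_deriv (omega n) p u v"
proof -
  obtain z w where zw: "p = (z, w)" by (cases p)
  obtain u1 u2 v1 v2 where uv: "u = (u1, u2)" "v = (v1, v2)" by (cases u, cases v)
  define N :: complex where "N = of_nat n"
  define q where "q = inverse N"
  define P where "P = w ^ (n - 1)"
  have q: "N * q = 1" using n by (simp add: q_def N_def)
  have P: "w ^ n = w * P" using n by (cases n) (auto simp: P_def)
  have S: "z * cnj z + w * cnj w = 1" using S3_cnj[of z w] p by (simp add: zw)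
  show ?thesis
    unfolding wedge11_def connection_form_def omega_def ext_deriv_omega P zw uv fst_conv snd_conv
      divide_inverse N_def[symmetric] q_def[symmetric] P_def[symmetric]
    using q S by algebra
qed

lemma wedge12_omega_self: "wedge12 (omega n) (ext_deriv (omega n)) p u v w = 0"
  unfolding wedge12_def ext_deriv_omega omega_def by algebra

lemma frame_values:
  fixes z w :: complex
  assumes n: "n \<ge> 1"
  defines "N \<equiv> of_nat n :: complex"
  defines "q \<equiv> inverse N" and "P \<equiv> w ^ (n - 1)" and "Z \<equiv> cnj z" and "W \<equiv> cnj w"
  defines "e1 \<equiv> frame1 (z, w)" and "e2 \<equiv> frame2 (z, w)" and "e3 \<equiv> frame3 (z, w)"
  defines "D \<equiv> ext_deriv (connection_form n) (z, w)"
  shows "omega n (z, w) e1 = \<i> * w * ((N - 1) * z + w * P)"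
    and "omega n (z, w) e2 = N * z * Z + w * W + w * P * Z"
    and "omega n (z, w) e3 = \<i> * (N * z * Z + w * W + w * P * Z)"
    and "connection_form n (z, w) e1 = \<i> * (N + 1) * (q * z * Z + w * W - q * P * w * Z)"
    and "connection_form n (z, w) e2 = (N + 1) * Z * ((1 - q) * W - q * Z * P)"
    and "connection_form n (z, w) e3 = \<i> * (N + 1) * Z * ((1 - q) * W - q * Z * P)"
    and "D e2 e3 = 2 * \<i> * (N + 1) * (q * w * W + z * Z + q * P * w * Z)"
    and "D e1 e3 = (N + 1) * ((1 - q) * (Z * W - z * w) - q * P * (Z * Z + w * w))"
    and "D e1 e2 = \<i> * (N + 1) * ((q - 1) * (Z * W + z * w) - q * P * (w * w - Z * Z))"
proof -
  have c: "cnj Z = z" "cnj W = w" by (simp_all add: Z_def W_def)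
  have P: "w ^ n = w * P" using n by (cases n) (auto simp: P_def)
  have I: "\<i> * (\<i> * x) = - x" for x by (simp flip: mult.assoc)
  note unf = D_def ext_deriv_connection_form connection_form_def omega_def e1_def e2_def e3_def
    frame1_def frame2_def frame3_def P fst_conv snd_conv divide_inverse
    complex_cnj_minus complex_cnj_mult complex_cnj_i
    Z_def[symmetric] W_def[symmetric] c P_def[symmetric] N_def[symmetric] q_def[symmetric]
  show "omega n (z, w) e1 = \<i> * w * ((N - 1) * z + w * P)"
    and "omega n (z, w) e2 = N * z * Z + w * W + w * P * Z"
    and "omega n (z, w) e3 = \<i> * (N * z * Z + w * W + w * P * Z)"
    and "connection_form n (z, w) e1 = \<i> * (N + 1) * (q * z * Z + w * W - q * P * w * Z)"
    and "connection_form n (z, w) e2 = (N + 1) * Z * ((1 - q) * W - q * Z * P)"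
    and "connection_form n (z, w) e3 = \<i> * (N + 1) * Z * ((1 - q) * W - q * Z * P)"
    and "D e2 e3 = 2 * \<i> * (N + 1) * (q * w * W + z * Z + q * P * w * Z)"
    and "D e1 e3 = (N + 1) * ((1 - q) * (Z * W - z * w) - q * P * (Z * Z + w * w))"
    and "D e1 e2 = \<i> * (N + 1) * ((q - 1) * (Z * W + z * w) - q * P * (w * w - Z * Z))"
    unfolding unf by (simp_all add: algebra_simps I)
qed

text \<open>
  Let \<open>\<alpha>\<close> be \<open>connection_form n\<close>.  On all of \<open>\<complex>\<^sup>2\<close> the product \<open>\<alpha> \<and> \<omega>\<^sub>n\<close> is \<open>(\<bar>z\<bar>\<^sup>2 + \<bar>w\<bar>\<^sup>2) d\<omega>\<^sub>n\<close>.  Taking \<open>d\<close> shows that \<open>d\<alpha> \<and> \<omega>\<^sub>n\<close> is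
  \<open>\<alpha> \<and> d\<omega>\<^sub>n\<close>, which vanishes as a form of type \<open>(3,0)\<close>, plus the product of \<open>d\<omega>\<^sub>n\<close> with the
  differential of \<open>\<bar>z\<bar>\<^sup>2 + \<bar>w\<bar>\<^sup>2\<close>, which vanishes on vectors tangent to spheres.  The proof verifies the resulting
  polynomial identity.
\<close>

lemma wedge12_omega_connection_form:
  assumes n: "n \<ge> 1"
  shows "wedge12 (omega n) (ext_deriv (connection_form n)) p (frame1 p) (frame2 p) (frame3 p) = 0"
proof -
  obtain z w where zw: "p = (z, w)" by (cases p)
  define N :: complex where "N = of_nat n"
  define q where "q = inverse N"
  have q: "N * q = 1" using n by (simp add: q_def N_def)
  define P Z W where "P = w ^ (n - 1)" and "Z = cnj z" and "W = cnj w"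
  define i where "i = \<i>"
  have i: "i * i = -1" by (simp add: i_def)
  show ?thesis
    unfolding wedge12_def zw frame_values[OF n] N_def[symmetric] q_def[symmetric]
      P_def[symmetric] Z_def[symmetric] W_def[symmetric] i_def[symmetric]
    using q i by algebra
qed

text \<open>
  The central computation: all terms containing \<open>w\<^bsup>n-1\<^esup>\<close> cancel, so the value is the one for the linear
  vector field \<open>n z \<partial>\<^sub>z + w \<partial>\<^sub>w\<close>, namely \<open>-2 (n + 1)\<^sup>2 / n\<close> times \<open>(\<bar>z\<bar>\<^sup>2 + \<bar>w\<bar>\<^sup>2)\<^sup>2\<close>.
\<close>

lemma wedge12_connection_form:
  assumes n: "n \<ge> 1" and p: "p \<in> S3"
  shows "wedge12 (connection_form n) (ext_deriv (connection_form n)) p (frame1 p) (frame2 p) (frame3 p)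
    = - 2 * (of_nat n + 1)\<^sup>2 / of_nat n"
proof -
  obtain z w where zw: "p = (z, w)" by (cases p)
  define N :: complex where "N = of_nat n"
  define q where "q = inverse N"
  have q: "N * q = 1" using n by (simp add: q_def N_def)
  have S: "z * cnj z + w * cnj w = 1" using S3_cnj[of z w] p by (simp add: zw)
  define P Z W where "P = w ^ (n - 1)" and "Z = cnj z" and "W = cnj w"
  define i where "i = \<i>"
  have i: "i * i = -1" by (simp add: i_def)
  have "wedge12 (connection_form n) (ext_deriv (connection_form n)) p (frame1 p) (frame2 p) (frame3 p)
      = - 2 * (N + 1)\<^sup>2 * q * (z * cnj z + w * cnj w)\<^sup>2"
    unfolding wedge12_def zw frame_values[OF n] N_def[symmetric] q_def[symmetric]
      P_def[symmetric] Z_def[symmetric] W_def[symmetric] i_def[symmetric]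
    using q i by algebra
  then show ?thesis by (simp add: S N_def q_def divide_inverse)
qed

text \<open>
  The value is \<open>n \<bar>z\<bar>\<^sup>2 + \<bar>w\<bar>\<^sup>2 + cnj z w\<^sup>n\<close>, whose real part is at least \<open>1 - \<bar>z\<bar> \<bar>w\<bar> \<ge> 1/2\<close>.  Geometrically:
  the complex line in the kernel of \<open>\<omega>\<^sub>n\<close> is transverse to the sphere.
\<close>

lemma omega_frame2_nonzero:
  assumes n: "n \<ge> 1" and p: "p \<in> S3"
  shows "omega n p (frame2 p) \<noteq> 0"
proof
  obtain z w where zw: "p = (z, w)" by (cases p)
  assume "omega n p (frame2 p) = 0"
  then have "of_nat n * (z * cnj z) + w * cnj w = - (w * w ^ (n - 1) * cnj z)"
    using frame_values(2)[OF n, of z w] by (simp add: zw eq_neg_iff_add_eq_0 mult.assoc)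
  then have "complex_of_real (real n * (norm z)\<^sup>2 + (norm w)\<^sup>2) = - (w * w ^ (n - 1) * cnj z)"
    by (simp only: of_real_add of_real_mult of_real_of_nat_eq complex_norm_square)
  then have "norm (complex_of_real (real n * (norm z)\<^sup>2 + (norm w)\<^sup>2)) = norm (w * w ^ (n - 1) * cnj z)"
    by simp
  then have eq: "real n * (norm z)\<^sup>2 + (norm w)\<^sup>2 = norm w * norm w ^ (n - 1) * norm z"
    by (simp add: norm_mult norm_power del: of_real_add of_real_mult)
  have 1: "(norm z)\<^sup>2 + (norm w)\<^sup>2 = 1" using p by (simp add: zw norm_Pair)
  have "norm w \<le> 1" using norm_snd_le[of w z] p by (simp add: zw)
  then have "norm w ^ (n - 1) \<le> 1" by (intro power_le_one) auto
  then have "norm w * norm w ^ (n - 1) * norm z \<le> norm w * 1 * norm z"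
    by (intro mult_right_mono mult_left_mono) auto
  moreover have "2 * (norm w * norm z) \<le> (norm z)\<^sup>2 + (norm w)\<^sup>2"
    using sum_squares_bound[of "norm w" "norm z"] by simp
  moreover have "1 * (norm z)\<^sup>2 \<le> real n * (norm z)\<^sup>2" using n by (intro mult_right_mono) auto
  ultimately show False using eq 1 by simp
qed

text \<open>
  The vectors \<open>frame2 p\<close> and \<open>frame3 p\<close> span a complex line, on which \<open>\<omega>\<^sub>n\<close> is complex linear and
  nonzero; so its real and imaginary parts are already independent there.
\<close>

lemma formally_integrable_omega:
  assumes n: "n \<ge> 1"
  shows "formally_integrable (omega n)"
  unfolding formally_integrable_def
proof (intro conjI ballI allI impI)
  show "smooth_form1_near_S3 (omega n)" by (rule smooth_omega)
next
  fix p and a b :: real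
  assume p: "p \<in> S3" and ab: "\<forall>v\<in>tangent_S3 p. a * Re (omega n p v) + b * Im (omega n p v) = 0"
  obtain z w where zw: "p = (z, w)" by (cases p)
  let ?c = "omega n p (frame2 p)"
  have f3: "omega n p (frame3 p) = \<i> * ?c" by (simp add: zw frame_values[OF n])
  have e: "a * Re ?c + b * Im ?c = 0" "b * Re ?c - a * Im ?c = 0"
    using ab[rule_format, OF frame_tangent(2)[of p]] ab[rule_format, OF frame_tangent(3)[of p]] f3 by auto
  have "Complex a (- b) * ?c = 0" using e by (simp add: complex_eq_iff)
  then have "Complex a (- b) = 0" using omega_frame2_nonzero[OF n p] by simp
  then show "a = 0" "b = 0" by (simp_all add: complex_eq_iff)
qed (rule wedge12_omega_self)


section \<open>The Bott integral of an arbitrary connection form\<close>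

lemma frame_eq_quarter_turn: "frame2 = quarter_turn 1" "frame3 = quarter_turn \<i>"
  by (auto simp: frame2_def frame3_def quarter_turn_def)

lemma bounded_linear_frame1: "bounded_linear frame1"
  unfolding frame1_def
  by (intro bounded_linear_Pair bounded_linear_const_mult bounded_linear_fst bounded_linear_snd)

text \<open>
  The difference \<open>\<beta>\<close> of a solution and \<open>connection_form n\<close> satisfies \<open>\<beta> \<and> \<omega>\<^sub>n = 0\<close> on the sphere, so it is a multiple of
  \<open>\<omega>\<^sub>n\<close> there.  Since \<open>connection_form n \<and> \<omega>\<^sub>n\<close> takes the constant value \<open>(n + 1) \<i>\<close> on the
  first two frame fields, the factor is, up to a constant, the value of
  \<open>connection_form n \<and> \<beta>\<close> on them; this formula makes sense and is of
  class \<open>C\<^sup>1\<close> near the sphere.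
\<close>

lemma connection_form_difference:
  assumes n: "n \<ge> 1" and \<alpha>: "smooth_form1_near_S3 \<alpha>"
    and eq: "\<And>p u v. p \<in> S3 \<Longrightarrow> u \<in> tangent_S3 p \<Longrightarrow> v \<in> tangent_S3 p \<Longrightarrow>
      ext_deriv (omega n) p u v = wedge11 \<alpha> (omega n) p u v"
  obtains U f where "open U" "S3 \<subseteq> U" "Ck_on 1 U f"
    "\<And>x. x \<in> U \<Longrightarrow> linear (\<alpha> x)" "\<And>v. Ck_on 1 U (\<lambda>x. \<alpha> x v)"
    "\<And>p v. p \<in> S3 \<Longrightarrow> v \<in> tangent_S3 p \<Longrightarrow> \<alpha> p v = connection_form n p v + f p * omega n p v"
proof -
  obtain U where U: "open U" "S3 \<subseteq> U" and lin: "\<And>x. x \<in> U \<Longrightarrow> linear (\<alpha> x)"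
    and C: "\<And>v. Ck_on 1 U (\<lambda>x. \<alpha> x v)"
    using \<alpha> unfolding smooth_form1_near_S3_def smooth_on_def by blast
  let ?c = "connection_form n"
  have Cc: "Ck_on 1 U (\<lambda>x. ?c x v)" for v
    by (rule Ck_on_connection_form[OF U(1)])
  define \<beta> where "\<beta> x v = \<alpha> x v - ?c x v" for x v
  have lin\<beta>: "linear (\<beta> x)" if "x \<in> U" for x
    unfolding \<beta>_def by (intro linear_compose_sub lin that linear_connection_form)
  have C\<beta>: "Ck_on 1 U (\<lambda>x. \<beta> x v)" for v
    unfolding \<beta>_def by (intro Ck_on_diff U C Cc)
  define f where "f x = - \<i> / (of_nat n + 1) *
      (?c x (frame1 x) * \<beta> x (frame2 x) - ?c x (frame2 x) * \<beta> x (frame1 x))" for x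
  have "Ck_on 1 U f"
    unfolding f_def
    by (intro Ck_on_mult Ck_on_diff Ck_on_const U
        Ck_on_form_linear_field[OF U(1) linear_connection_form Cc]
        Ck_on_form_linear_field[OF U(1) lin\<beta> C\<beta>]
        bounded_linear_frame1 bounded_linear_quarter_turn[of 1, folded frame_eq_quarter_turn])
  moreover have "\<alpha> p v = ?c p v + f p * omega n p v" if p: "p \<in> S3" and v: "v \<in> tangent_S3 p" for p v
  proof -
    have b: "\<beta> p u * omega n p v = \<beta> p v * omega n p u" if "u \<in> tangent_S3 p" for u
      using eq[OF p that v] wedge11_connection_form_omega[OF n p, of u v]
      by (simp add: \<beta>_def wedge11_def algebra_simps)
    have b12: "\<beta> p (frame1 p) * omega n p v = \<beta> p v * omega n p (frame1 p)"
      "\<beta> p (frame2 p) * omega n p v = \<beta> p v * omega n p (frame2 p)"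
      by (rule b, rule frame_tangent)+
    have w12: "?c p (frame1 p) * omega n p (frame2 p) - ?c p (frame2 p) * omega n p (frame1 p) =
        (of_nat n + 1) * \<i>"
      using wedge11_connection_form_omega[OF n p, of "frame1 p" "frame2 p"]
      by (simp add: wedge11_def ext_deriv_omega_frame(3)[OF p])
    have "f p * omega n p v = - \<i> / (of_nat n + 1) *
      (?c p (frame1 p) * (\<beta> p (frame2 p) * omega n p v) - ?c p (frame2 p) * (\<beta> p (frame1 p) * omega n p v))"
      by (simp add: f_def algebra_simps)
    also have "\<dots> = - \<i> / (of_nat n + 1) * (\<beta> p v *
       (?c p (frame1 p) * omega n p (frame2 p) - ?c p (frame2 p) * omega n p (frame1 p)))"
      unfolding b12 by (simp add: algebra_simps)
    also have "\<dots> = \<beta> p v * ((of_nat n + 1) / (of_nat n + 1))"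
      unfolding w12 by (simp add: ac_simps)
    also have "complex_of_nat n + 1 \<noteq> 0"
      by (metis of_nat_Suc of_nat_eq_0_iff nat.distinct(1) add.commute)
    then have "\<beta> p v * ((of_nat n + 1) / (of_nat n + 1)) = \<beta> p v" by simp
    finally show ?thesis by (simp add: \<beta>_def)
  qed
  ultimately show thesis using that U lin C by blast
qed

text \<open>
  All solutions of \<open>d\<omega>\<^sub>n = \<alpha> \<and> \<omega>\<^sub>n\<close> have the same integral: pointwise \<open>\<alpha> \<and> d\<alpha>\<close> differs from the constant
  obtained for \<open>connection_form n\<close> by derivatives of \<open>f\<close> along the rotation fields \<open>frame2\<close> and \<open>frame3\<close>.
\<close>

lemma integral_S3_connection:
  assumes n: "n \<ge> 1" and \<alpha>: "smooth_form1_near_S3 \<alpha>"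
    and eq: "\<And>p u v. p \<in> S3 \<Longrightarrow> u \<in> tangent_S3 p \<Longrightarrow> v \<in> tangent_S3 p \<Longrightarrow>
      ext_deriv (omega n) p u v = wedge11 \<alpha> (omega n) p u v"
  shows "integral_S3 (wedge12 \<alpha> (ext_deriv \<alpha>)) =
    complex_of_real (- 4 * pi\<^sup>2 * ((real n + 1)\<^sup>2 / real n))"
proof -
  obtain U f where U: "open U" "S3 \<subseteq> U" and f: "Ck_on 1 U f"
    and lin: "\<And>x. x \<in> U \<Longrightarrow> linear (\<alpha> x)" and C: "\<And>v. Ck_on 1 U (\<lambda>x. \<alpha> x v)"
    and \<alpha>f: "\<And>p v. p \<in> S3 \<Longrightarrow> v \<in> tangent_S3 p \<Longrightarrow> \<alpha> p v = connection_form n p v + f p * omega n p v"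
    using connection_form_difference[OF n \<alpha> eq] by blast
  let ?c = "connection_form n"
  define h where "h c p = frechet_derivative f (at p) (quarter_turn c p)" for c p
  define K :: complex where "K = - 2 * (of_nat n + 1)\<^sup>2 / of_nat n"
  have da: "(\<lambda>x. \<alpha> x v) differentiable (at p)" if "p \<in> U" for p v
    by (rule Ck_on_1_differentiable[OF C that])
  have dc: "(\<lambda>x. ?c x v) differentiable (at p)" for p v
    by (rule Ck_on_1_differentiable[OF Ck_on_connection_form[OF open_UNIV] UNIV_I])
  have dw: "(\<lambda>x. omega n x v) differentiable (at p)" for p v
    by (rule Ck_on_1_differentiable[OF Ck_on_omega[OF open_UNIV] UNIV_I])
  have df: "f differentiable (at p)" if "p \<in> U" for p
    by (rule Ck_on_1_differentiable[OF f that])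
  (* Leibniz rule for alpha - connection_form n - f * omega n, which vanishes on tangent vectors. *)
  have ext: "ext_deriv \<alpha> p u v = ext_deriv ?c p u v +
      (frechet_derivative f (at p) u * omega n p v - frechet_derivative f (at p) v * omega n p u
       + f p * ext_deriv (omega n) p u v)"
    if p: "p \<in> S3" and u: "u \<in> tangent_S3 p" and v: "v \<in> tangent_S3 p" for p u v
  proof -
    define \<gamma> where "\<gamma> = (\<lambda>x v. \<alpha> x v - ?c x v - f x * omega n x v)"
    have pU: "p \<in> U" using p U by blast
    have "ext_deriv \<gamma> p u v = 0"
    proof (rule ext_deriv_tangent_zero[OF U _ _ _ p u v])
      show "linear (\<gamma> x)" if "x \<in> U" for x
        unfolding \<gamma>_def
        using linear_compose_sub[OF linear_compose_sub[OF lin[OF that] linear_connection_form[of n x]]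
          linear_compose[OF linear_omega[of n x] linear_times[of "f x"]]] by (simp add: o_def)
      show "(\<lambda>x. \<gamma> x v) differentiable (at x)" if "x \<in> U" for x v
        unfolding \<gamma>_def
        by (intro differentiable_diff differentiable_mult da[OF that] dc dw df[OF that])
      show "\<gamma> x v = 0" if "x \<in> S3" "v \<in> tangent_S3 x" for x v
        using \<alpha>f[OF that] by (simp add: \<gamma>_def)
    qed
    then show ?thesis
      unfolding \<gamma>_def ext_deriv_combination[OF da[OF pU] dc dw df[OF pU]]
      by (simp add: algebra_simps)
  qed
  have pointwise: "wedge12 \<alpha> (ext_deriv \<alpha>) p (frame1 p) (frame2 p) (frame3 p) =
      K - (of_nat n + 1) * (h 1 p + \<i> * h \<i> p)" if p: "p \<in> S3" for p
  proof -
    have tan: "x \<in> {frame1 p, frame2 p, frame3 p} \<Longrightarrow> x \<in> tangent_S3 p" for x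
      using frame_tangent[of p] by blast
    have d: "wedge12 (\<lambda>_. frechet_derivative f (at p)) (ext_deriv (omega n)) p (frame1 p) (frame2 p) (frame3 p) =
        (of_nat n + 1) * (h 1 p + \<i> * h \<i> p)"
      by (simp add: wedge12_def ext_deriv_omega_frame[OF p] h_def frame_eq_quarter_turn[symmetric] algebra_simps)
    have "wedge12 \<alpha> (ext_deriv \<alpha>) p (frame1 p) (frame2 p) (frame3 p) =
      wedge12 ?c (ext_deriv ?c) p (frame1 p) (frame2 p) (frame3 p) -
      wedge12 (\<lambda>_. frechet_derivative f (at p)) (ext_deriv (omega n)) p (frame1 p) (frame2 p) (frame3 p)"
      by (rule wedge12_change_of_connection[of _ _ _ \<alpha> p ?c "f p" "omega n"])
        (use tan \<alpha>f[OF p] ext[OF p] wedge11_connection_form_omega[OF n p] wedge12_omega_connection_form[OF n] in \<open>simp_all only:\<close>)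
    then show ?thesis by (simp only: d wedge12_connection_form[OF n p] K_def)
  qed
  have hc: "continuous_on S3 (h c)" for c
    unfolding h_def
    by (rule continuous_on_subset[OF continuous_on_frechet_derivative_along[OF f] U(2)])
      (rule linear_continuous_on[OF bounded_linear_quarter_turn])
  have int_h: "set_integrable sphere_measure S3 (\<lambda>p. d * h c p)" for c d
    by (intro set_integrable_S3_continuous continuous_on_mult_left hc)
  have h0: "(LINT p:S3|sphere_measure. h c p) = 0" if "norm c = 1" for c
    unfolding h_def by (rule integral_rotation_derivative[OF that U f])
  have "integral_S3 (wedge12 \<alpha> (ext_deriv \<alpha>)) =
      (LINT p:S3|sphere_measure. K - ((of_nat n + 1) * h 1 p + ((of_nat n + 1) * \<i>) * h \<i> p))"
    unfolding integral_S3_def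
    by (rule set_lebesgue_integral_cong) (auto simp: pointwise algebra_simps)
  also have "\<dots> = (LINT p:S3|sphere_measure. K) -
      ((LINT p:S3|sphere_measure. (of_nat n + 1) * h 1 p) + (LINT p:S3|sphere_measure. ((of_nat n + 1) * \<i>) * h \<i> p))"
    by (simp only: set_integral_diff(2)[OF set_integrable_S3_continuous[OF continuous_on_const]
          set_integral_add(1)[OF int_h int_h]] set_integral_add(2)[OF int_h int_h])
  also have "\<dots> = (LINT p:S3|sphere_measure. K)"
    by (simp add: h0)
  also have "\<dots> = measure sphere_measure S3 *\<^sub>R K"
  proof -
    have "emeasure (sphere_measure :: complex2 measure) S3 < \<infinity>"
      using finite_measure.emeasure_finite[OF finite_measure_sphere_measure] by (simp add: less_top)
    then have "has_bochner_integral sphere_measure (indicat_real S3) (measure (sphere_measure :: complex2 measure) S3)"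
      by (intro has_bochner_integral_real_indicator) simp_all
    then have "has_bochner_integral sphere_measure (\<lambda>p. indicat_real S3 p *\<^sub>R K) (measure sphere_measure S3 *\<^sub>R K)"
      by (intro has_bochner_integral_scaleR_left)
    then show ?thesis
      unfolding set_lebesgue_integral_def by (rule has_bochner_integral_integral_eq)
  qed
  also have "\<dots> = complex_of_real (- 4 * pi\<^sup>2 * ((real n + 1)\<^sup>2 / real n))"
    by (simp add: measure_sphere_measure_S3 K_def scaleR_conv_of_real)
  finally show ?thesis .
qed

theorem proposition4p10:
  fixes n :: nat
  assumes "n \<ge> 1"
  shows "bott_invariant (omega n) = complex_of_real (- 4 * pi\<^sup>2 * ((real n + 1)\<^sup>2 / real n))"
  unfolding bott_invariant_def
proof (rule the_equality)
  show "formally_integrable (omega n) \<and> (\<exists>\<alpha>. smooth_form1_near_S3 \<alpha> \<and>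
        (\<forall>p\<in>S3. \<forall>u\<in>tangent_S3 p. \<forall>v\<in>tangent_S3 p.
           ext_deriv (omega n) p u v = wedge11 \<alpha> (omega n) p u v) \<and>
        complex_of_real (- 4 * pi\<^sup>2 * ((real n + 1)\<^sup>2 / real n)) = integral_S3 (wedge12 \<alpha> (ext_deriv \<alpha>)))"
    using formally_integrable_omega[OF assms] smooth_connection_form[of n]
      wedge11_connection_form_omega[OF assms]
      integral_S3_connection[OF assms smooth_connection_form wedge11_connection_form_omega[OF assms, symmetric]]
    by (intro conjI exI[of _ "connection_form n"]) auto
qed (use integral_S3_connection[OF assms] in blast)

end
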